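(* Let $\mathcal H$ be a complex Hilbert space, let $\mathcal A$ be a unital operator algebra in $\mathcal B(\mathcal H)$, and let $\mathcal U$ be a (linear) subspace of $\mathcal B(\mathcal H)$. Then: (1) $\mathcal U$ is a reflexive right $\mathcal A$-submodule if and only if there exists $\phi\in\mathrm{Hom}(\mathrm{Lat}\,\mathcal A,\mathcal P)$ such that $\mathcal U=\{T\in\mathcal B(\mathcal H): TE\subseteq\phi(E)\ \text{for all } E\in\mathrm{Lat}\,\mathcal A\}$. (2) $\mathcal U$ is a $*$-reflexive left $\mathcal A$-submodule if and only if there exists $\psi\in\mathrm{Hom}(\mathrm{Lat}\,\mathcal A,\mathcal P)$ such that $\mathcal U=\{T\in\mathcal B(\mathcal H): T\psi(E)\subseteq E\ \text{for all } E\in\mathrm{Lat}\,\mathcal A\}$.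
   Context: $\mathcal B(\mathcal H)$ is the algebra of bounded linear operators on $\mathcal H$, and $\mathcal P$ is the complete lattice of all orthogonal projections in $\mathcal B(\mathcal H)$. Projections are identified with their ranges (closed subspaces); thus $TE\subseteq F$ means that $T$ maps the range of $E$ into the range of $F$. A unital operator algebra is a subalgebra of $\mathcal B(\mathcal H)$ containing the identity $I$. $\mathrm{Lat}\,\mathcal A$ is the complete lattice of all projections $E\in\mathcal P$ invariant under every element of $\mathcal A$ ($AE\subseteq E$ for all $A\in\mathcal A$). $\mathrm{Hom}(\mathrm{Lat}\,\mathcal A,\mathcal P)$ is the set of order homomorphisms from $\mathrm{Lat}\,\mathcal A$ into $\mathcal P$, i.e. maps $\phi$ such that $E\le F$ implies $\phi(E)\le\phi(F)$. A right (left) $\mathcal A$-submodule is a linear subspace $\mathcal U\subseteq\mathcal B(\mathcal H)$ with $\mathcal U\mathcal A\subseteq\mathcal U$ ($\mathcal A\,\mathcal U\subseteq\mathcal U$). $[\cdot]$ denotes closed linear span. For a linear subspace $\mathcal S\subseteq\mathcal B(\mathcal H)$, $\mathrm{Ref}\,\mathcal S=\{T\in\mathcal B(\mathcal H): Tx\in[\mathcal Sx]\ \text{for all } x\in\mathcal H\}$; $\mathcal S$ is reflexive if $\mathcal S=\mathrm{Ref}\,\mathcal S$, and $*$-reflexive if $\mathcal S^*=\{S^*:S\in\mathcal S\}$ is reflexive. *)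

theory Defs
  imports "HOL-Analysis.Analysis"
begin

text \<open>
  A complex Hilbert space is a Banach space (in the sense of the library, i.e. over the reals)
  with a complex scalar multiplication extending the real one and a complex inner product,
  linear in the first argument, that induces the norm.
\<close>

class chilbert_space = banach +
  fixes scaleC :: "complex \<Rightarrow> 'a \<Rightarrow> 'a"  (infixr "*\<^sub>C" 75)
    and cinner :: "'a \<Rightarrow> 'a \<Rightarrow> complex"
  assumes scaleC_add_right: "c *\<^sub>C (x + y) = c *\<^sub>C x + c *\<^sub>C y"
    and scaleC_add_left: "(c + d) *\<^sub>C x = c *\<^sub>C x + d *\<^sub>C x"
    and scaleC_scaleC: "c *\<^sub>C d *\<^sub>C x = (c * d) *\<^sub>C x"
    and scaleC_of_real: "complex_of_real r *\<^sub>C x = r *\<^sub>R x"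
    and cinner_commute: "cinner x y = cnj (cinner y x)"
    and cinner_add_left: "cinner (x + y) z = cinner x z + cinner y z"
    and cinner_scaleC_left: "cinner (c *\<^sub>C x) y = c * cinner x y"
    and cinner_self_norm: "cinner x x = complex_of_real ((norm x)\<^sup>2)"

instantiation complex :: chilbert_space
begin

definition scaleC_complex :: "complex \<Rightarrow> complex \<Rightarrow> complex"
  where "scaleC_complex c x = c * x"

definition cinner_complex :: "complex \<Rightarrow> complex \<Rightarrow> complex"
  where "cinner_complex x y = x * cnj y"

instance
  by standard
    (simp_all add: scaleC_complex_def cinner_complex_def algebra_simps scaleR_conv_of_real
      complex_norm_square[symmetric] del: of_real_power)

end

lemma scaleC_one: "1 *\<^sub>C (x::'a::chilbert_space) = x"
  using scaleC_of_real[of 1 x] by simp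

global_interpretation cvec: vector_space "scaleC :: complex \<Rightarrow> 'a \<Rightarrow> 'a::chilbert_space"
  defines cspan = cvec.span
  by unfold_locales (simp_all add: scaleC_add_right scaleC_add_left scaleC_scaleC scaleC_one)

definition closed_cspan :: "'a::chilbert_space set \<Rightarrow> 'a set"
  where "closed_cspan X = closure (cspan X)"


subsection \<open>Bounded operators and projections\<close>

definition bounded_ops :: "('a::chilbert_space \<Rightarrow> 'a) set"
  where "bounded_ops = {T. bounded_linear T \<and> (\<forall>c x. T (c *\<^sub>C x) = c *\<^sub>C T x)}"

definition op_adjoint :: "('a::chilbert_space \<Rightarrow> 'a) \<Rightarrow> ('a \<Rightarrow> 'a)"
  where "op_adjoint T = (THE S. \<forall>x y. cinner (T x) y = cinner x (S y))"

definition projections :: "('a::chilbert_space \<Rightarrow> 'a) set"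
  where "projections =
    {P \<in> bounded_ops. P \<circ> P = P \<and> (\<forall>x y. cinner (P x) y = cinner x (P y))}"

text \<open>The order on projections is inclusion of their ranges.\<close>

definition proj_le :: "('a::chilbert_space \<Rightarrow> 'a) \<Rightarrow> ('a \<Rightarrow> 'a) \<Rightarrow> bool"
  where "proj_le E F \<longleftrightarrow> range E \<subseteq> range F"


subsection \<open>Operator algebras, submodules, invariant projections\<close>

definition op_subspace :: "('a::chilbert_space \<Rightarrow> 'a) set \<Rightarrow> bool"
  where "op_subspace \<U> \<longleftrightarrow>
    \<U> \<subseteq> bounded_ops \<and> (\<lambda>x. 0) \<in> \<U> \<and>
    (\<forall>S\<in>\<U>. \<forall>T\<in>\<U>. (\<lambda>x. S x + T x) \<in> \<U>) \<and>
    (\<forall>c. \<forall>T\<in>\<U>. (\<lambda>x. c *\<^sub>C T x) \<in> \<U>)"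

definition unital_op_algebra :: "('a::chilbert_space \<Rightarrow> 'a) set \<Rightarrow> bool"
  where "unital_op_algebra \<A> \<longleftrightarrow>
    op_subspace \<A> \<and> id \<in> \<A> \<and> (\<forall>S\<in>\<A>. \<forall>T\<in>\<A>. S \<circ> T \<in> \<A>)"

definition right_submodule ::
    "('a::chilbert_space \<Rightarrow> 'a) set \<Rightarrow> ('a \<Rightarrow> 'a) set \<Rightarrow> bool"
  where "right_submodule \<A> \<U> \<longleftrightarrow> op_subspace \<U> \<and> (\<forall>T\<in>\<U>. \<forall>A\<in>\<A>. T \<circ> A \<in> \<U>)"

definition left_submodule ::
    "('a::chilbert_space \<Rightarrow> 'a) set \<Rightarrow> ('a \<Rightarrow> 'a) set \<Rightarrow> bool"
  where "left_submodule \<A> \<U> \<longleftrightarrow> op_subspace \<U> \<and> (\<forall>T\<in>\<U>. \<forall>A\<in>\<A>. A \<circ> T \<in> \<U>)"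

definition Lat :: "('a::chilbert_space \<Rightarrow> 'a) set \<Rightarrow> ('a \<Rightarrow> 'a) set"
  where "Lat \<A> = {E \<in> projections. \<forall>A\<in>\<A>. A ` range E \<subseteq> range E}"

text \<open>
  Order homomorphisms are represented by total functions, of which only the values on the
  domain \<open>L\<close> are constrained.
\<close>

definition order_homs ::
    "('a::chilbert_space \<Rightarrow> 'a) set \<Rightarrow> ('a \<Rightarrow> 'a) set \<Rightarrow> (('a \<Rightarrow> 'a) \<Rightarrow> ('a \<Rightarrow> 'a)) set"
  where "order_homs L M = {\<phi> \<in> L \<rightarrow> M. monotone_on L proj_le proj_le \<phi>}"


subsection \<open>Reflexivity\<close>

definition Ref :: "('a::chilbert_space \<Rightarrow> 'a) set \<Rightarrow> ('a \<Rightarrow> 'a) set"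
  where "Ref \<S> = {T \<in> bounded_ops. \<forall>x. T x \<in> closed_cspan ((\<lambda>S. S x) ` \<S>)}"

definition reflexive_ops :: "('a::chilbert_space \<Rightarrow> 'a) set \<Rightarrow> bool"
  where "reflexive_ops \<S> \<longleftrightarrow> \<S> = Ref \<S>"

definition star_reflexive_ops :: "('a::chilbert_space \<Rightarrow> 'a) set \<Rightarrow> bool"
  where "star_reflexive_ops \<S> \<longleftrightarrow> reflexive_ops (op_adjoint ` \<S>)"

end

theory Submission
  imports Defs
begin

text \<open>
  For the right-module case let \<open>\<phi> E\<close> be the projection onto the closed span of the images
  \<open>T ` range E\<close> with \<open>T \<in> \<U>\<close>. Then \<open>\<phi>\<close> is monotone and every member of \<open>\<U>\<close> maps \<open>range E\<close>
  into \<open>range (\<phi> E)\<close>. The point is the converse, and here the cyclic subspaces decide: for a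
  vector \<open>x\<close>, the closed span \<open>W\<close> of the orbit of \<open>x\<close> under \<open>\<A>\<close> contains \<open>x\<close> and is invariant,
  and \<open>\<U>\<close> maps \<open>W\<close> into the closed span of the orbit of \<open>x\<close> under \<open>\<U>\<close>, because \<open>\<U> \<A> \<subseteq> \<U>\<close>. So an
  operator that respects \<open>\<phi>\<close> at the projection onto \<open>W\<close> sends \<open>x\<close> into the closed span of \<open>\<U> x\<close>;
  as \<open>x\<close> is arbitrary, it lies in \<open>Ref \<U> = \<U>\<close>. This is
  \<open>reflexive_right_submodule_imp_order_hom\<close>. Conversely, a space cut out by conditions
  \<open>T ` range E \<subseteq> range (\<phi> E)\<close> is reflexive since ranges of projections are closed subspaces, and
  a right module since each \<open>range E\<close> is invariant
  (\<open>order_hom_imp_reflexive_right_submodule\<close>).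

  The left-module case is the right-module case for the adjoint algebra and the adjoint space.
  Passing to orthogonal complements turns \<open>T ` range P \<subseteq> range Q\<close> into the opposite inclusion for
  the adjoint of \<open>T\<close> (\<open>op_adjoint_image_subset_iff\<close>). It therefore exchanges the invariant
  projections of \<open>\<A>\<close> and of its adjoint, and the homomorphism \<open>\<psi>\<close> corresponds to the
  conjugate of \<open>\<psi>\<close> by complementation, which is again monotone as complementation
  reverses the order twice.

  Both arguments rest on two classical facts: the projection theorem for closed subspaces, which
  provides \<open>\<phi> E\<close> and the projection onto \<open>W\<close>, and the Riesz representation theorem, which
  provides adjoints.
\<close>

section \<open>The complex inner product\<close>

lemma cinner_add_right: "cinner (x::'a::chilbert_space) (y + z) = cinner x y + cinner x z"
  by (simp add: cinner_commute[of x] cinner_add_left)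

lemma cinner_scaleC_right: "cinner (x::'a::chilbert_space) (c *\<^sub>C y) = cnj c * cinner x y"
  by (simp add: cinner_commute[of x] cinner_scaleC_left)

lemma cinner_diff_left: "cinner (x - y) (z::'a::chilbert_space) = cinner x z - cinner y z"
  using cinner_add_left[of "x - y" y z] by simp

lemma cinner_diff_right: "cinner (x::'a::chilbert_space) (y - z) = cinner x y - cinner x z"
  using cinner_add_right[of x "y - z" z] by simp

lemma cinner_zero_left [simp]: "cinner 0 (x::'a::chilbert_space) = 0"
  using cinner_diff_left[of x x x] by simp

lemma cinner_zero_right [simp]: "cinner (x::'a::chilbert_space) 0 = 0"
  using cinner_diff_right[of x x x] by simp

lemma cinner_self_eq_0_iff [simp]: "cinner x x = 0 \<longleftrightarrow> (x::'a::chilbert_space) = 0"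
  by (simp add: cinner_self_norm)

lemma cinner_extensionality:
  assumes "\<And>z. cinner z x = cinner z (y::'a::chilbert_space)"
  shows "x = y"
  using assms[of "x - y"] cinner_diff_right[of "x - y" x y] by simp

lemma norm_scaleC: "norm (c *\<^sub>C (x::'a::chilbert_space)) = cmod c * norm x"
proof -
  have "complex_of_real ((norm (c *\<^sub>C x))\<^sup>2) = (c * cnj c) * cinner x x"
    unfolding cinner_self_norm[symmetric] by (simp add: cinner_scaleC_left cinner_scaleC_right)
  also have "\<dots> = complex_of_real ((cmod c * norm x)\<^sup>2)"
    by (simp only: cinner_self_norm complex_norm_square[symmetric] power_mult_distrib of_real_mult)
  finally have "complex_of_real ((norm (c *\<^sub>C x))\<^sup>2) = complex_of_real ((cmod c * norm x)\<^sup>2)" .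
  then have "(norm (c *\<^sub>C x))\<^sup>2 = (cmod c * norm x)\<^sup>2"
    by (simp only: of_real_eq_iff)
  then show ?thesis
    by (simp add: power2_eq_iff_nonneg)
qed

lemma norm_add_squared:
  "(norm (x + y))\<^sup>2 = (norm x)\<^sup>2 + (norm y)\<^sup>2 + 2 * Re (cinner x (y::'a::chilbert_space))"
proof -
  have "cinner (x + y) (x + y) = cinner x x + cinner y y + (cinner x y + cnj (cinner x y))"
    by (simp add: cinner_add_left cinner_add_right flip: cinner_commute)
  then have "Re (cinner (x + y) (x + y)) = Re (cinner x x) + Re (cinner y y) + 2 * Re (cinner x y)"
    by simp
  then show ?thesis
    by (simp only: cinner_self_norm Re_complex_of_real)
qed

lemma norm_diff_scaleC_squared:
  "(norm (x - c *\<^sub>C y))\<^sup>2 =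
    (norm x)\<^sup>2 + (cmod c * norm y)\<^sup>2 - 2 * Re (cnj c * cinner x (y::'a::chilbert_space))"
proof -
  have eq: "x - c *\<^sub>C y = x + (- c) *\<^sub>C y"
    by (simp add: cvec.scale_minus_left)
  show ?thesis
    unfolding eq norm_add_squared norm_scaleC cinner_scaleC_right by simp
qed

text \<open>
  For \<open>y \<noteq> 0\<close> the point \<open>(cinner x y / (norm y)\<^sup>2) *\<^sub>C y\<close> is the orthogonal projection of \<open>x\<close>
  onto the line spanned by \<open>y\<close>. Non-negativity of the left side gives the Cauchy--Schwarz
  inequality. Moreover, subtracting this multiple of \<open>y\<close> strictly shortens \<open>x\<close> unless \<open>x\<close> is
  orthogonal to \<open>y\<close>, and this yields the orthogonality property of nearest points.
\<close>

lemma norm_diff_line_projection_squared: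
  assumes "(y::'a::chilbert_space) \<noteq> 0"
  shows "(norm (x - (cinner x y / complex_of_real ((norm y)\<^sup>2)) *\<^sub>C y))\<^sup>2 =
    (norm x)\<^sup>2 - (cmod (cinner x y) / norm y)\<^sup>2"
proof -
  let ?c = "cinner x y / complex_of_real ((norm y)\<^sup>2)"
  have "cnj ?c * cinner x y = complex_of_real ((cmod (cinner x y) / norm y)\<^sup>2)"
    by (simp add: power_divide complex_norm_square[of "cinner x y"] mult.commute
        del: of_real_power)
  then have "Re (cnj ?c * cinner x y) = (cmod (cinner x y) / norm y)\<^sup>2"
    by (simp only: Re_complex_of_real)
  moreover have "cmod ?c * norm y = cmod (cinner x y) / norm y"
    using assms by (simp add: norm_divide norm_power norm_mult power2_eq_square)
  ultimately show ?thesis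
    unfolding norm_diff_scaleC_squared by simp
qed

lemma cinner_Cauchy_Schwarz: "cmod (cinner x y) \<le> norm x * norm (y::'a::chilbert_space)"
proof (cases "y = 0")
  case False
  then have "0 \<le> (norm x)\<^sup>2 - (cmod (cinner x y) / norm y)\<^sup>2"
    unfolding norm_diff_line_projection_squared[OF False, symmetric] by simp
  then have "(cmod (cinner x y) / norm y)\<^sup>2 \<le> (norm x)\<^sup>2"
    by simp
  then have "cmod (cinner x y) / norm y \<le> norm x"
    by (rule power2_le_imp_le) simp
  then show ?thesis
    using False by (simp add: divide_le_eq)
qed simp

lemma parallelogram_law:
  "(norm (x - y))\<^sup>2 + (norm (x + y))\<^sup>2 = 2 * (norm x)\<^sup>2 + 2 * (norm (y::'a::chilbert_space))\<^sup>2"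
  using norm_diff_scaleC_squared[of x 1 y] norm_add_squared[of x y] by (simp add: scaleC_one)


section \<open>Closed subspaces\<close>

lemma scaleC_scaleR_commute: "r *\<^sub>R c *\<^sub>C x = c *\<^sub>C r *\<^sub>R (x::'a::chilbert_space)"
  by (simp add: scaleC_scaleC mult.commute flip: scaleC_of_real)

lemma bounded_linear_scaleC: "bounded_linear (\<lambda>x::'a::chilbert_space. c *\<^sub>C x)"
  by (rule bounded_linear_intro[of _ "cmod c"])
    (simp_all add: scaleC_add_right scaleC_scaleR_commute norm_scaleC mult.commute)

lemma csubspace_scaleR:
  assumes "cvec.subspace S" "(x::'a::chilbert_space) \<in> S"
  shows "r *\<^sub>R x \<in> S"
  using cvec.subspace_scale[OF assms, of "complex_of_real r"] by (simp add: scaleC_of_real)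

lemma csubspace_closure:
  assumes S: "cvec.subspace (S::'a::chilbert_space set)"
  shows "cvec.subspace (closure S)"
proof (rule cvec.subspaceI)
  show "0 \<in> closure S"
    using cvec.subspace_0[OF S] closure_subset by blast
  fix x y c
  assume x: "x \<in> closure S"
  then obtain u where u: "\<And>n. u n \<in> S" "u \<longlonglongrightarrow> x"
    by (auto simp: closure_sequential)
  have "(\<lambda>n. c *\<^sub>C u n) \<longlonglongrightarrow> c *\<^sub>C x"
    by (rule bounded_linear.tendsto[OF bounded_linear_scaleC u(2)])
  then show "c *\<^sub>C x \<in> closure S"
    unfolding closure_sequential
    by (intro exI[of _ "\<lambda>n. c *\<^sub>C u n"] conjI allI cvec.subspace_scale[OF S] u(1))
  assume "y \<in> closure S"
  then obtain v where v: "\<And>n. v n \<in> S" "v \<longlonglongrightarrow> y"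
    by (auto simp: closure_sequential)
  have "(\<lambda>n. u n + v n) \<longlonglongrightarrow> x + y"
    by (rule tendsto_add[OF u(2) v(2)])
  then show "x + y \<in> closure S"
    unfolding closure_sequential
    by (intro exI[of _ "\<lambda>n. u n + v n"] conjI allI cvec.subspace_add[OF S] u(1) v(1))
qed

lemma csubspace_closed_cspan: "cvec.subspace (closed_cspan X)"
  unfolding closed_cspan_def by (simp add: csubspace_closure cvec.subspace_span)

lemma closed_closed_cspan: "closed (closed_cspan X)"
  unfolding closed_cspan_def by simp

lemma closed_cspan_superset: "X \<subseteq> closed_cspan X"
  unfolding closed_cspan_def using cvec.span_superset closure_subset by blast

lemma closed_cspan_minimal:
  "X \<subseteq> S \<Longrightarrow> cvec.subspace S \<Longrightarrow> closed S \<Longrightarrow> closed_cspan X \<subseteq> S"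
  unfolding closed_cspan_def by (simp add: closure_minimal cvec.span_minimal)

lemma closed_cspan_mono: "X \<subseteq> Y \<Longrightarrow> closed_cspan X \<subseteq> closed_cspan Y"
  unfolding closed_cspan_def by (simp add: closure_mono cvec.span_mono)

text \<open>
  This is the form in which continuity and linearity of operators enter: the preimage of a closed
  subspace is a closed subspace, so it suffices to control an operator on a spanning set.
\<close>

lemma bounded_op_closed_cspan:
  assumes T: "T \<in> bounded_ops"
    and X: "\<And>x. x \<in> X \<Longrightarrow> T x \<in> S" and S: "cvec.subspace S" "closed S"
    and y: "y \<in> closed_cspan X"
  shows "T y \<in> S"
proof -
  interpret T: bounded_linear T
    using T by (simp add: bounded_ops_def)
  have "closed (T -` S)"
    by (rule continuous_closed_vimage[OF S(2)]) (simp add: T.isCont)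
  moreover have "cvec.subspace (T -` S)"
    using T S(1)
    by (auto intro!: cvec.subspaceI simp: T.zero T.add bounded_ops_def
        cvec.subspace_0 cvec.subspace_add cvec.subspace_scale)
  ultimately have "closed_cspan X \<subseteq> T -` S"
    using X by (intro closed_cspan_minimal) auto
  then show ?thesis
    using y by blast
qed


section \<open>The projection theorem\<close>

text \<open>
  A minimizing sequence for the distance from \<open>x\<close> is Cauchy: midpoints of its members stay in
  the subspace, so by the parallelogram law two nearly optimal points are close to each other.
\<close>

lemma closed_csubspace_nearest_point:
  fixes S :: "'a::chilbert_space set"
  assumes S: "cvec.subspace S" and cl: "closed S"
  shows "\<exists>y\<in>S. \<forall>z\<in>S. norm (x - y) \<le> norm (x - z)"
proof -
  define d where "d = (INF z\<in>S. (norm (x - z))\<^sup>2)"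
  have ne: "S \<noteq> {}"
    using cvec.subspace_0[OF S] by blast
  have bdd: "bdd_below ((\<lambda>z. (norm (x - z))\<^sup>2) ` S)"
    by (rule bdd_belowI[of _ 0]) auto
  have lower: "d \<le> (norm (x - z))\<^sup>2" if "z \<in> S" for z
    unfolding d_def by (rule cINF_lower[OF bdd that])
  have "\<exists>z\<in>S. (norm (x - z))\<^sup>2 < d + e" if "e > 0" for e
    using cINF_less_iff[OF ne bdd, of "d + e"] that unfolding d_def by simp
  then have "\<exists>z. z \<in> S \<and> (norm (x - z))\<^sup>2 < d + 1 / real (Suc n)" for n
    using zero_less_divide_1_iff[of "real (Suc n)"] by (metis of_nat_0_less_iff zero_less_Suc)
  then obtain u where u: "\<And>n. u n \<in> S" "\<And>n. (norm (x - u n))\<^sup>2 < d + 1 / real (Suc n)"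
    by metis
  have gap: "(norm (u m - u n))\<^sup>2 \<le> 2 / real (Suc m) + 2 / real (Suc n)" for m n
  proof -
    \<comment> \<open>Applied to \<open>x - u m\<close> and \<open>x - u n\<close>, the parallelogram law involves the distance from \<open>x\<close>
      to the midpoint \<open>h\<close>, which is bounded below by minimality.\<close>
    define h where "h = (1/2) *\<^sub>R (u m + u n)"
    have h: "u m + u n = h + h"
      unfolding h_def by (simp flip: scaleR_add_left)
    have "h \<in> S"
      unfolding h_def by (intro csubspace_scaleR[OF S] cvec.subspace_add[OF S] u)
    then have "d \<le> (norm (x - h))\<^sup>2"
      by (rule lower)
    moreover have "(x - u m) + (x - u n) = 2 *\<^sub>R (x - h)"
      by (simp only: add_diff_add[symmetric] h scaleR_2)
    then have "(norm ((x - u m) + (x - u n)))\<^sup>2 = 4 * (norm (x - h))\<^sup>2"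
      by (simp only: norm_scaleR) (simp add: power_mult_distrib)
    ultimately have "4 * d \<le> (norm ((x - u m) + (x - u n)))\<^sup>2"
      by simp
    moreover have "(norm (u m - u n))\<^sup>2 = (norm ((x - u m) - (x - u n)))\<^sup>2"
      by (simp add: norm_minus_commute)
    ultimately show ?thesis
      using parallelogram_law[of "x - u m" "x - u n"] u(2)[of m] u(2)[of n] by simp
  qed
  have "Cauchy u"
  proof (rule metric_CauchyI)
    fix e :: real
    assume e: "e > 0"
    \<comment> \<open>Beyond \<open>N\<close> both terms of \<open>gap\<close> are at most \<open>2 / N\<close>, and their sum must stay below \<open>e\<^sup>2\<close>.\<close>
    then obtain N where N: "4 / e\<^sup>2 < real N"
      using reals_Archimedean2 by blast
    show "\<exists>M. \<forall>m\<ge>M. \<forall>n\<ge>M. dist (u m) (u n) < e"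
    proof (intro exI allI impI)
      fix m n
      assume "m \<ge> N" "n \<ge> N"
      have "0 < 4 / e\<^sup>2"
        using e by simp
      then have N0: "0 < real N"
        using N by linarith
      have "2 / real (Suc m) \<le> 2 / real N" "2 / real (Suc n) \<le> 2 / real N"
        using N0 \<open>m \<ge> N\<close> \<open>n \<ge> N\<close> by (auto intro!: divide_left_mono)
      then have "(norm (u m - u n))\<^sup>2 \<le> 4 / real N"
        using gap[of m n] by simp
      also have "\<dots> < e\<^sup>2"
        using N N0 e by (simp add: field_simps)
      finally show "dist (u m) (u n) < e"
        unfolding dist_norm by (rule power2_less_imp_less) (use e in simp)
    qed
  qed
  then obtain y where y: "u \<longlonglongrightarrow> y"
    unfolding Cauchy_convergent_iff convergent_def ..
  have "y \<in> S"
    by (rule closed_sequentially[OF cl u(1) y])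
  moreover have "norm (x - y) \<le> norm (x - z)" if "z \<in> S" for z
  proof -
    have "(\<lambda>n. (norm (x - u n))\<^sup>2) \<longlonglongrightarrow> (norm (x - y))\<^sup>2"
      by (intro tendsto_intros y)
    moreover have "(\<lambda>n. d + 1 / real (Suc n)) \<longlonglongrightarrow> d + 0"
      by (intro tendsto_add tendsto_const LIMSEQ_Suc[OF lim_1_over_n])
    ultimately have "(norm (x - y))\<^sup>2 \<le> d + 0"
      by (rule LIMSEQ_le) (intro exI[of _ 0] allI impI less_imp_le u(2))
    also have "d + 0 \<le> (norm (x - z))\<^sup>2"
      using lower[OF that] by simp
    finally show ?thesis
      by (rule power2_le_imp_le) simp
  qed
  ultimately show ?thesis
    by blast
qed

text \<open>
  If \<open>x - y\<close> were not orthogonal to some \<open>z\<close> in the subspace, moving the nearest point \<open>y\<close> by a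
  suitable multiple of \<open>z\<close> would bring it closer to \<open>x\<close>.
\<close>

lemma closed_csubspace_orthogonal_decomposition:
  fixes S :: "'a::chilbert_space set"
  assumes S: "cvec.subspace S" and cl: "closed S"
  shows "\<exists>y\<in>S. \<forall>z\<in>S. cinner (x - y) z = 0"
proof -
  obtain y where y: "y \<in> S" "\<And>z. z \<in> S \<Longrightarrow> norm (x - y) \<le> norm (x - z)"
    using closed_csubspace_nearest_point[OF S cl, of x] by blast
  have "cinner (x - y) z = 0" if z: "z \<in> S" for z
  proof (cases "z = 0")
    case False
    let ?c = "cinner (x - y) z / complex_of_real ((norm z)\<^sup>2)"
    have "y + ?c *\<^sub>C z \<in> S"
      by (intro cvec.subspace_add[OF S] cvec.subspace_scale[OF S] y z)
    then have "norm (x - y) \<le> norm ((x - y) - ?c *\<^sub>C z)"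
      using y(2)[of "y + ?c *\<^sub>C z"] by (simp add: algebra_simps)
    then have "(norm (x - y))\<^sup>2 \<le> (norm ((x - y) - ?c *\<^sub>C z))\<^sup>2"
      by (simp add: power_mono)
    then have "(cmod (cinner (x - y) z) / norm z)\<^sup>2 \<le> 0"
      unfolding norm_diff_line_projection_squared[OF False] by simp
    then show ?thesis
      using False by simp
  qed simp
  then show ?thesis
    using y(1) by blast
qed

definition proj_onto :: "'a::chilbert_space set \<Rightarrow> 'a \<Rightarrow> 'a"
  where "proj_onto S x = (SOME y. y \<in> S \<and> (\<forall>z\<in>S. cinner (x - y) z = 0))"

lemma
  fixes S :: "'a::chilbert_space set"
  assumes "cvec.subspace S" "closed S"
  shows proj_onto_in: "proj_onto S x \<in> S"
    and proj_onto_orthogonal: "z \<in> S \<Longrightarrow> cinner (x - proj_onto S x) z = 0"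
  using someI_ex[of "\<lambda>y. y \<in> S \<and> (\<forall>z\<in>S. cinner (x - y) z = 0)"]
    closed_csubspace_orthogonal_decomposition[OF assms, of x]
  unfolding proj_onto_def by blast+

lemma proj_onto_eqI:
  fixes S :: "'a::chilbert_space set"
  assumes S: "cvec.subspace S" "closed S"
    and y: "y \<in> S" "\<And>z. z \<in> S \<Longrightarrow> cinner (x - y) z = 0"
  shows "proj_onto S x = y"
proof -
  let ?d = "proj_onto S x - y"
  have d: "?d \<in> S"
    by (intro cvec.subspace_diff S(1) y(1) proj_onto_in[OF S])
  have "cinner ?d ?d = cinner (x - y) ?d - cinner (x - proj_onto S x) ?d"
    by (simp flip: cinner_diff_left)
  also have "\<dots> = 0"
    by (simp add: y(2)[OF d] proj_onto_orthogonal[OF S d])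
  finally show ?thesis
    by simp
qed

lemma
  fixes S :: "'a::chilbert_space set"
  assumes S: "cvec.subspace S" "closed S"
  shows proj_onto_in_projections: "proj_onto S \<in> projections"
    and range_proj_onto: "range (proj_onto S) = S"
proof -
  note mem = proj_onto_in[OF S] and orth = proj_onto_orthogonal[OF S]
  have fixed: "proj_onto S y = y" if "y \<in> S" for y
    using that by (intro proj_onto_eqI[OF S]) auto
  have add: "proj_onto S (x + y) = proj_onto S x + proj_onto S y" for x y
  proof (rule proj_onto_eqI[OF S cvec.subspace_add[OF S(1) mem mem]])
    fix z assume z: "z \<in> S"
    have "cinner (x + y - (proj_onto S x + proj_onto S y)) z =
        cinner (x - proj_onto S x) z + cinner (y - proj_onto S y) z"
      by (simp add: cinner_add_left cinner_diff_left)
    then show "cinner (x + y - (proj_onto S x + proj_onto S y)) z = 0"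
      by (simp add: orth z)
  qed
  have scale: "proj_onto S (c *\<^sub>C x) = c *\<^sub>C proj_onto S x" for c x
  proof (rule proj_onto_eqI[OF S cvec.subspace_scale[OF S(1) mem]])
    fix z assume z: "z \<in> S"
    show "cinner (c *\<^sub>C x - c *\<^sub>C proj_onto S x) z = 0"
      unfolding cvec.scale_right_diff_distrib[symmetric] cinner_scaleC_left orth[OF z] by simp
  qed
  have bound: "norm (proj_onto S x) \<le> norm x" for x
  proof -
    have "(norm (x - proj_onto S x + proj_onto S x))\<^sup>2 =
        (norm (x - proj_onto S x))\<^sup>2 + (norm (proj_onto S x))\<^sup>2"
      unfolding norm_add_squared orth[OF mem] by simp
    then have "(norm (proj_onto S x))\<^sup>2 \<le> (norm x)\<^sup>2"
      by simp
    then show ?thesis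
      by (rule power2_le_imp_le) simp
  qed
  have "bounded_linear (proj_onto S)"
    by (rule bounded_linear_intro[of _ 1])
      (simp_all add: add bound scale flip: scaleC_of_real)
  moreover have "cinner (proj_onto S x) y = cinner x (proj_onto S y)" for x y
  proof -
    have "cinner (proj_onto S x) (y - proj_onto S y) = 0"
      using orth[OF mem, of y x] cinner_commute[of "proj_onto S x" "y - proj_onto S y"] by simp
    moreover have "cinner (x - proj_onto S x) (proj_onto S y) = 0"
      by (rule orth[OF mem])
    ultimately show ?thesis
      by (simp add: cinner_diff_left cinner_diff_right)
  qed
  ultimately show "proj_onto S \<in> projections"
    by (auto simp: projections_def bounded_ops_def scale fixed mem fun_eq_iff)
  show "range (proj_onto S) = S"
    using mem fixed by (metis image_subsetI rangeI subsetI subset_antisym)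
qed


section \<open>Projections and their complements\<close>

lemma bounded_opsD:
  assumes "T \<in> bounded_ops"
  shows "bounded_linear T" "T (c *\<^sub>C x) = c *\<^sub>C T x" "T (x + y) = T x + T y"
    "T (x - y) = T x - T y" "T 0 = 0"
  using assms by (auto simp: bounded_ops_def linear_simps)

lemma projectionsD:
  assumes "E \<in> projections"
  shows "E \<in> bounded_ops" "E (E x) = E x" "cinner (E x) y = cinner x (E y)"
  using assms by (auto simp: projections_def fun_eq_iff)

lemma mem_range_projection_iff:
  assumes "E \<in> projections"
  shows "x \<in> range E \<longleftrightarrow> E x = x"
  using projectionsD(2)[OF assms] by (metis rangeE rangeI)

lemma csubspace_range_projection:
  assumes "E \<in> projections"
  shows "cvec.subspace (range E)"
  using bounded_opsD[OF projectionsD(1)[OF assms]]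
  by (auto intro!: cvec.subspaceI
      simp: mem_range_projection_iff[OF assms] projectionsD(2)[OF assms])

lemma closed_range_projection:
  assumes "E \<in> projections"
  shows "closed (range E)"
proof -
  have "continuous_on UNIV E"
    using bounded_opsD(1)[OF projectionsD(1)[OF assms]]
    by (rule linear_continuous_on)
  then have "closed {x. E x = x}"
    by (intro closed_Collect_eq continuous_on_id)
  moreover have "range E = {x. E x = x}"
    using mem_range_projection_iff[OF assms] by blast
  ultimately show ?thesis
    by simp
qed

definition proj_compl :: "('a::chilbert_space \<Rightarrow> 'a) \<Rightarrow> 'a \<Rightarrow> 'a"
  where "proj_compl E x = x - E x"

lemma proj_compl_proj_compl [simp]: "proj_compl (proj_compl E) = E"
  by (simp add: proj_compl_def fun_eq_iff)

lemma proj_compl_in_projections: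
  assumes "E \<in> projections"
  shows "proj_compl E \<in> projections"
proof -
  note E = projectionsD[OF assms] and b = bounded_opsD[OF projectionsD(1)[OF assms]]
  have "bounded_linear (proj_compl E)"
    unfolding proj_compl_def by (intro bounded_linear_sub bounded_linear_ident b)
  then show ?thesis
    unfolding projections_def bounded_ops_def
    by (auto simp: proj_compl_def fun_eq_iff E b cvec.scale_right_diff_distrib
        cinner_diff_left cinner_diff_right)
qed

lemma mem_range_proj_compl_iff:
  assumes "E \<in> projections"
  shows "x \<in> range (proj_compl E) \<longleftrightarrow> (\<forall>y\<in>range E. cinner x y = 0)"
proof -
  have "x \<in> range (proj_compl E) \<longleftrightarrow> E x = 0"
    unfolding mem_range_projection_iff[OF proj_compl_in_projections[OF assms]]
    by (simp add: proj_compl_def)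
  also have "\<dots> \<longleftrightarrow> (\<forall>y\<in>range E. cinner x y = 0)"
  proof
    assume r: "\<forall>y\<in>range E. cinner x y = 0"
    have "cinner (E x) (E x) = cinner x (E (E x))"
      by (rule projectionsD(3)[OF assms])
    also have "\<dots> = 0"
      using r by blast
    finally show "E x = 0"
      by simp
  qed (auto simp flip: projectionsD(3)[OF assms])
  finally show ?thesis .
qed

lemma proj_le_proj_compl:
  assumes "E \<in> projections" "F \<in> projections" "proj_le E F"
  shows "proj_le (proj_compl F) (proj_compl E)"
  using assms(3) unfolding proj_le_def subset_iff
    mem_range_proj_compl_iff[OF assms(1)] mem_range_proj_compl_iff[OF assms(2)] by blast


section \<open>Adjoints\<close>

text \<open>
  If the functional is not zero, the Riesz vector spans the orthogonal complement of the kernel;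
  a vector \<open>w\<close> in that complement exists by the projection theorem, and \<open>f w *\<^sub>C x - f x *\<^sub>C w\<close>
  lies in the kernel, so orthogonality to \<open>w\<close> determines \<open>f x\<close>.
\<close>

lemma Riesz_representation:
  fixes f :: "'a::chilbert_space \<Rightarrow> complex"
  assumes f: "bounded_linear f" and fC: "\<And>c x. f (c *\<^sub>C x) = c * f x"
  shows "\<exists>v. \<forall>x. f x = cinner x v"
proof (cases "\<forall>x. f x = 0")
  case True
  then show ?thesis
    by (intro exI[of _ 0]) simp
next
  case False
  then obtain x0 where x0: "f x0 \<noteq> 0"
    by blast
  interpret f: bounded_linear f
    by (rule f)
  define K where "K = {x. f x = 0}"
  have K: "cvec.subspace K"
    unfolding K_def by (auto intro!: cvec.subspaceI simp: f.zero f.add fC)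
  have clK: "closed K"
    unfolding K_def by (intro closed_Collect_eq linear_continuous_on f continuous_on_const)
  obtain y where y: "y \<in> K" and orth: "\<And>z. z \<in> K \<Longrightarrow> cinner (x0 - y) z = 0"
    using closed_csubspace_orthogonal_decomposition[OF K clK, of x0] by blast
  define w where "w = x0 - y"
  have fw: "f w \<noteq> 0"
    using x0 y by (simp add: w_def f.diff K_def)
  then have w: "cinner w w \<noteq> 0"
    using f.zero by auto
  have eq: "f x * cinner w w = f w * cinner x w" for x
  proof -
    have "f w *\<^sub>C x - f x *\<^sub>C w \<in> K"
      by (simp add: K_def f.diff fC)
    then have "cinner w (f w *\<^sub>C x - f x *\<^sub>C w) = 0"
      using orth w_def by simp
    then have "cinner (f w *\<^sub>C x - f x *\<^sub>C w) w = 0"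
      using cinner_commute[of "f w *\<^sub>C x - f x *\<^sub>C w" w] by simp
    then show ?thesis
      by (simp add: cinner_diff_left cinner_scaleC_left)
  qed
  have "f x = cinner x (cnj (f w / cinner w w) *\<^sub>C w)" for x
    using eq[of x] w by (simp add: cinner_scaleC_right field_simps)
  then show ?thesis
    by blast
qed

lemma op_adjoint_eqI:
  assumes "\<And>x y. cinner (T x) y = cinner x (S y)"
  shows "op_adjoint T = S"
  unfolding op_adjoint_def
proof (rule the_equality)
  fix R assume R: "\<forall>x y. cinner (T x) y = cinner x (R y)"
  show "R = S"
    by (rule ext, rule cinner_extensionality) (metis R assms)
qed (use assms in blast)

lemma cinner_op_adjoint:
  assumes T: "T \<in> bounded_ops"
  shows "cinner (T x) y = cinner x (op_adjoint T y)"
proof -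
  interpret T: bounded_linear T
    by (rule bounded_opsD(1)[OF T])
  have "bounded_linear (\<lambda>x. cinner (T x) y)" for y
  proof (rule bounded_linear_intro)
    fix x
    have "cmod (cinner (T x) y) \<le> norm (T x) * norm y"
      by (rule cinner_Cauchy_Schwarz)
    also have "\<dots> \<le> (norm x * onorm T) * norm y"
      using onorm[OF T.bounded_linear_axioms, of x] by (simp add: mult.commute mult_left_mono)
    finally show "cmod (cinner (T x) y) \<le> norm x * (onorm T * norm y)"
      by (simp add: mult.assoc)
  next
    fix r x
    have "T (r *\<^sub>R x) = complex_of_real r *\<^sub>C T x"
      by (simp add: T.scaleR scaleC_of_real)
    then show "cinner (T (r *\<^sub>R x)) y = r *\<^sub>R cinner (T x) y"
      by (simp add: cinner_scaleC_left scaleR_conv_of_real)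
  qed (simp add: T.add cinner_add_left)
  then have Riesz: "\<exists>v. \<forall>x. cinner (T x) y = cinner x v" for y
    by (rule Riesz_representation) (simp add: bounded_opsD(2)[OF T] cinner_scaleC_left)
  define S where "S y = (SOME v. \<forall>x. cinner (T x) y = cinner x v)" for y
  have S: "cinner (T x) y = cinner x (S y)" for x y
    unfolding S_def using someI_ex[OF Riesz, of y] by (rule spec)
  have "op_adjoint T = S"
    by (rule op_adjoint_eqI) (rule S)
  then show ?thesis
    by (simp only: S)
qed

lemma cinner_op_adjoint':
  assumes "T \<in> bounded_ops"
  shows "cinner (op_adjoint T x) y = cinner x (T y)"
  using cinner_op_adjoint[OF assms, of y x] cinner_commute[of "op_adjoint T x" y]
    cinner_commute[of x "T y"] by simp

lemma op_adjoint_in_bounded_ops: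
  assumes T: "T \<in> bounded_ops"
  shows "op_adjoint T \<in> bounded_ops"
proof -
  let ?S = "op_adjoint T"
  note adj = cinner_op_adjoint[OF T, symmetric]
  have add: "?S (x + y) = ?S x + ?S y" for x y
    by (rule cinner_extensionality) (simp add: adj cinner_add_right)
  have scale: "?S (c *\<^sub>C x) = c *\<^sub>C ?S x" for c x
    by (rule cinner_extensionality) (simp add: adj cinner_scaleC_right)
  have bound: "norm (?S x) \<le> norm x * onorm T" for x
  proof (cases "?S x = 0")
    case True
    then show ?thesis
      using onorm_pos_le[OF bounded_opsD(1)[OF T]] by simp
  next
    case False
    have "(norm (?S x))\<^sup>2 = cmod (cinner (?S x) (?S x))"
      by (simp add: cinner_self_norm norm_power)
    also have "\<dots> = cmod (cinner (T (?S x)) x)"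
      by (simp add: adj)
    also have "\<dots> \<le> norm (T (?S x)) * norm x"
      by (rule cinner_Cauchy_Schwarz)
    also have "\<dots> \<le> (onorm T * norm (?S x)) * norm x"
      by (intro mult_right_mono onorm bounded_opsD(1)[OF T]) simp
    finally show ?thesis
      using False by (simp add: power2_eq_square mult_ac)
  qed
  have "bounded_linear ?S"
    by (rule bounded_linear_intro[OF add _ bound]) (simp add: scale flip: scaleC_of_real)
  then show ?thesis
    by (simp add: bounded_ops_def scale)
qed

lemma op_adjoint_op_adjoint:
  assumes "T \<in> bounded_ops"
  shows "op_adjoint (op_adjoint T) = T"
  by (rule op_adjoint_eqI) (rule cinner_op_adjoint'[OF assms])

lemma op_adjoint_comp:
  assumes "S \<in> bounded_ops" "T \<in> bounded_ops"
  shows "op_adjoint (S \<circ> T) = op_adjoint T \<circ> op_adjoint S"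
  by (rule op_adjoint_eqI) (simp add: cinner_op_adjoint[OF assms(1)] cinner_op_adjoint[OF assms(2)])

lemma op_adjoint_add:
  assumes "S \<in> bounded_ops" "T \<in> bounded_ops"
  shows "op_adjoint (\<lambda>x. S x + T x) = (\<lambda>x. op_adjoint S x + op_adjoint T x)"
  by (rule op_adjoint_eqI)
    (simp add: cinner_op_adjoint[OF assms(1)] cinner_op_adjoint[OF assms(2)]
      cinner_add_left cinner_add_right)

lemma op_adjoint_scaleC:
  assumes "T \<in> bounded_ops"
  shows "op_adjoint (\<lambda>x. c *\<^sub>C T x) = (\<lambda>x. cnj c *\<^sub>C op_adjoint T x)"
  by (rule op_adjoint_eqI)
    (simp add: cinner_op_adjoint[OF assms] cinner_scaleC_left cinner_scaleC_right)

lemma op_adjoint_zero: "op_adjoint (\<lambda>x. 0) = (\<lambda>x. 0)"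
  by (rule op_adjoint_eqI) simp

lemma op_adjoint_id: "op_adjoint id = id"
  by (rule op_adjoint_eqI) simp

lemma op_adjoint_image_invol:
  assumes "\<U> \<subseteq> bounded_ops"
  shows "op_adjoint ` op_adjoint ` \<U> = \<U>"
proof -
  have "op_adjoint ` op_adjoint ` \<U> = id ` \<U>"
    unfolding image_image using assms by (intro image_cong) (auto simp: op_adjoint_op_adjoint)
  then show ?thesis
    by simp
qed

lemma op_subspace_op_adjoint:
  assumes U: "op_subspace \<U>"
  shows "op_subspace (op_adjoint ` \<U>)"
proof -
  have sub: "T \<in> bounded_ops" if "T \<in> \<U>" for T
    using U that by (auto simp: op_subspace_def)
  have zero: "(\<lambda>x. 0) \<in> \<U>"
    and add: "\<And>S T. S \<in> \<U> \<Longrightarrow> T \<in> \<U> \<Longrightarrow> (\<lambda>x. S x + T x) \<in> \<U>"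
    and scale: "\<And>c T. T \<in> \<U> \<Longrightarrow> (\<lambda>x. c *\<^sub>C T x) \<in> \<U>"
    using U by (auto simp: op_subspace_def)
  have "(\<lambda>x. 0) \<in> op_adjoint ` \<U>"
    using imageI[OF zero, of op_adjoint] unfolding op_adjoint_zero .
  moreover have "(\<lambda>x. op_adjoint S x + op_adjoint T x) \<in> op_adjoint ` \<U>"
    if "S \<in> \<U>" "T \<in> \<U>" for S T
    using imageI[OF add[OF that], of op_adjoint]
    unfolding op_adjoint_add[OF sub[OF that(1)] sub[OF that(2)]] .
  moreover have "(\<lambda>x. c *\<^sub>C op_adjoint T x) \<in> op_adjoint ` \<U>" if "T \<in> \<U>" for c T
    using imageI[OF scale[OF that, of "cnj c"], of op_adjoint]
    unfolding op_adjoint_scaleC[OF sub[OF that]] complex_cnj_cnj .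
  moreover have "op_adjoint ` \<U> \<subseteq> bounded_ops"
    using sub op_adjoint_in_bounded_ops by blast
  ultimately show ?thesis
    unfolding op_subspace_def ball_simps(9) by blast
qed

lemma unital_op_algebra_op_adjoint:
  assumes A: "unital_op_algebra \<A>"
  shows "unital_op_algebra (op_adjoint ` \<A>)"
proof -
  have sub: "T \<in> bounded_ops" if "T \<in> \<A>" for T
    using A that by (auto simp: unital_op_algebra_def op_subspace_def)
  have one: "id \<in> \<A>" and mult: "\<And>S T. S \<in> \<A> \<Longrightarrow> T \<in> \<A> \<Longrightarrow> S \<circ> T \<in> \<A>"
    using A by (auto simp: unital_op_algebra_def)
  have "id \<in> op_adjoint ` \<A>"
    using imageI[OF one, of op_adjoint] unfolding op_adjoint_id .
  moreover have "op_adjoint S \<circ> op_adjoint T \<in> op_adjoint ` \<A>" if "S \<in> \<A>" "T \<in> \<A>" for S T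
    using imageI[OF mult[OF that(2,1)], of op_adjoint]
    unfolding op_adjoint_comp[OF sub[OF that(2)] sub[OF that(1)]] .
  moreover have "op_subspace (op_adjoint ` \<A>)"
    using A by (simp add: unital_op_algebra_def op_subspace_op_adjoint)
  ultimately show ?thesis
    unfolding unital_op_algebra_def ball_simps(9) by blast
qed

text \<open>
  Taking adjoints reverses products, so right multiplication by adjoints of elements of \<open>\<A>\<close> is
  the adjoint of left multiplication by these elements.
\<close>

lemma right_submodule_op_adjoint_iff:
  assumes A: "\<A> \<subseteq> bounded_ops" and U: "op_subspace \<U>"
  shows "right_submodule (op_adjoint ` \<A>) (op_adjoint ` \<U>) \<longleftrightarrow> left_submodule \<A> \<U>"
proof -
  have sub: "\<U> \<subseteq> bounded_ops"
    using U by (simp add: op_subspace_def)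
  have "op_adjoint T \<circ> op_adjoint A \<in> op_adjoint ` \<U> \<longleftrightarrow> A \<circ> T \<in> \<U>"
    if "T \<in> \<U>" "A \<in> \<A>" for T A
  proof -
    have T: "T \<in> bounded_ops" and A': "A \<in> bounded_ops"
      using that A sub by auto
    have AT: "op_adjoint (op_adjoint T \<circ> op_adjoint A) = A \<circ> T"
      by (simp add: op_adjoint_comp op_adjoint_op_adjoint op_adjoint_in_bounded_ops T A')
    have "A \<circ> T \<in> \<U>" if "op_adjoint T \<circ> op_adjoint A \<in> op_adjoint ` \<U>"
      using imageI[OF that, of op_adjoint] unfolding AT op_adjoint_image_invol[OF sub] .
    moreover have "op_adjoint T \<circ> op_adjoint A \<in> op_adjoint ` \<U>" if "A \<circ> T \<in> \<U>"
      using imageI[OF that, of op_adjoint] by (simp add: op_adjoint_comp T A')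
    ultimately show ?thesis
      by blast
  qed
  then show ?thesis
    unfolding right_submodule_def left_submodule_def
    by (simp add: U op_subspace_op_adjoint)
qed


section \<open>Duality between invariant projections of an algebra and its adjoint\<close>

text \<open>
  Both inclusions say that \<open>cinner (T x) y = 0\<close> whenever \<open>x\<close> lies in the range of \<open>P\<close> and \<open>y\<close> is
  orthogonal to the range of \<open>Q\<close>.
\<close>

lemma op_adjoint_image_subset_iff:
  assumes T: "T \<in> bounded_ops" and P: "P \<in> projections" and Q: "Q \<in> projections"
  shows "op_adjoint T ` range (proj_compl Q) \<subseteq> range (proj_compl P) \<longleftrightarrow> T ` range P \<subseteq> range Q"
proof -
  have Q': "y \<in> range Q \<longleftrightarrow> (\<forall>z\<in>range (proj_compl Q). cinner y z = 0)" for y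
    using mem_range_proj_compl_iff[OF proj_compl_in_projections[OF Q]] by simp
  have sym: "cinner (op_adjoint T z) x = 0 \<longleftrightarrow> cinner (T x) z = 0" for x z
    using cinner_op_adjoint'[OF T, of z x] cinner_commute[of z "T x"] by simp
  have "op_adjoint T ` range (proj_compl Q) \<subseteq> range (proj_compl P) \<longleftrightarrow>
      (\<forall>z\<in>range (proj_compl Q). \<forall>x\<in>range P. cinner (T x) z = 0)"
    unfolding image_subset_iff mem_range_proj_compl_iff[OF P] sym by simp
  also have "\<dots> \<longleftrightarrow> T ` range P \<subseteq> range Q"
    unfolding image_subset_iff Q' by blast
  finally show ?thesis .
qed

lemma proj_compl_in_Lat_op_adjoint:
  assumes "\<A> \<subseteq> bounded_ops" "E \<in> Lat \<A>"
  shows "proj_compl E \<in> Lat (op_adjoint ` \<A>)"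
proof -
  have E: "E \<in> projections" and inv: "\<And>A. A \<in> \<A> \<Longrightarrow> A ` range E \<subseteq> range E"
    using assms(2) by (auto simp: Lat_def)
  have "op_adjoint A ` range (proj_compl E) \<subseteq> range (proj_compl E)" if "A \<in> \<A>" for A
    using op_adjoint_image_subset_iff[OF subsetD[OF assms(1) that] E E] inv[OF that] by blast
  then show ?thesis
    unfolding Lat_def using proj_compl_in_projections[OF E] by blast
qed

lemma proj_compl_in_Lat:
  assumes A: "\<A> \<subseteq> bounded_ops" and F: "F \<in> Lat (op_adjoint ` \<A>)"
  shows "proj_compl F \<in> Lat \<A>"
proof -
  have "proj_compl F \<in> Lat (op_adjoint ` op_adjoint ` \<A>)"
    by (rule proj_compl_in_Lat_op_adjoint[OF _ F]) (use A op_adjoint_in_bounded_ops in blast)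
  then show ?thesis
    unfolding op_adjoint_image_invol[OF A] .
qed

text \<open>
  Complementation reverses the order, once before and once after applying \<open>\<phi>\<close>, so the conjugate
  of \<open>\<phi>\<close> is monotone again.
\<close>

lemma order_homs_proj_compl:
  assumes \<phi>: "\<phi> \<in> order_homs L projections"
    and M: "M \<subseteq> projections" "\<And>F. F \<in> M \<Longrightarrow> proj_compl F \<in> L"
  shows "(\<lambda>F. proj_compl (\<phi> (proj_compl F))) \<in> order_homs M projections"
proof -
  have \<phi>1: "\<phi> E \<in> projections" if "E \<in> L" for E
    using \<phi> that by (auto simp: order_homs_def)
  have \<phi>2: "proj_le (\<phi> E) (\<phi> F)" if "E \<in> L" "F \<in> L" "proj_le E F" for E F
    using \<phi> that by (auto simp: order_homs_def monotone_on_def)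
  have "monotone_on M proj_le proj_le (\<lambda>F. proj_compl (\<phi> (proj_compl F)))"
  proof (rule monotone_onI)
    fix E F
    assume "E \<in> M" "F \<in> M" "proj_le E F"
    then show "proj_le (proj_compl (\<phi> (proj_compl E))) (proj_compl (\<phi> (proj_compl F)))"
      using M by (intro proj_le_proj_compl \<phi>1 \<phi>2) auto
  qed
  then show ?thesis
    using M(2) \<phi>1 by (auto simp: order_homs_def proj_compl_in_projections)
qed

text \<open>
  Under \<open>F = proj_compl E\<close> the conditions defining the two sets correspond one by one through
  \<open>op_adjoint_image_subset_iff\<close>. Thus adjoints carry a space of the form occurring in the
  left-module case to one of the form occurring in the right-module case.
\<close>

lemma op_adjoint_image_left_conditions:
  assumes A: "\<A> \<subseteq> bounded_ops" and \<psi>: "\<And>E. E \<in> Lat \<A> \<Longrightarrow> \<psi> E \<in> projections"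
  shows "op_adjoint ` {T \<in> bounded_ops. \<forall>E\<in>Lat \<A>. T ` range (\<psi> E) \<subseteq> range E} =
    {T \<in> bounded_ops. \<forall>F\<in>Lat (op_adjoint ` \<A>).
      T ` range F \<subseteq> range (proj_compl (\<psi> (proj_compl F)))}"
    (is "op_adjoint ` ?L = ?R")
proof -
  have iff: "op_adjoint T \<in> ?R \<longleftrightarrow> T \<in> ?L" if T: "T \<in> bounded_ops" for T
  proof -
    have "(\<forall>F\<in>Lat (op_adjoint ` \<A>).
          op_adjoint T ` range F \<subseteq> range (proj_compl (\<psi> (proj_compl F)))) \<longleftrightarrow>
        (\<forall>E\<in>Lat \<A>. op_adjoint T ` range (proj_compl E) \<subseteq> range (proj_compl (\<psi> E)))"
      (is "?lhs \<longleftrightarrow> ?rhs")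
    proof (intro iffI ballI)
      fix E assume "?lhs" "E \<in> Lat \<A>"
      from bspec[OF this(1) proj_compl_in_Lat_op_adjoint[OF A this(2)]]
      show "op_adjoint T ` range (proj_compl E) \<subseteq> range (proj_compl (\<psi> E))"
        by (simp only: proj_compl_proj_compl)
    next
      fix F assume "?rhs" "F \<in> Lat (op_adjoint ` \<A>)"
      from bspec[OF this(1) proj_compl_in_Lat[OF A this(2)]]
      show "op_adjoint T ` range F \<subseteq> range (proj_compl (\<psi> (proj_compl F)))"
        by (simp only: proj_compl_proj_compl)
    qed
    also have "\<dots> \<longleftrightarrow> (\<forall>E\<in>Lat \<A>. T ` range (\<psi> E) \<subseteq> range E)"
      by (intro ball_cong refl op_adjoint_image_subset_iff T \<psi>) (auto simp: Lat_def)
    finally show ?thesis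
      by (simp add: T op_adjoint_in_bounded_ops)
  qed
  show ?thesis
  proof (intro subset_antisym subsetI)
    fix S assume "S \<in> op_adjoint ` ?L"
    then obtain T where T: "S = op_adjoint T" "T \<in> ?L"
      by (rule imageE)
    then have "T \<in> bounded_ops"
      by simp
    from iff[OF this] T(2) show "S \<in> ?R"
      unfolding T(1) by (rule iffD2)
  next
    fix S assume S: "S \<in> ?R"
    then have b: "S \<in> bounded_ops"
      by simp
    have "op_adjoint S \<in> ?L"
      using iff[OF op_adjoint_in_bounded_ops[OF b]] S unfolding op_adjoint_op_adjoint[OF b] by blast
    then have "op_adjoint (op_adjoint S) \<in> op_adjoint ` ?L"
      by (rule imageI)
    then show "S \<in> op_adjoint ` ?L"
      unfolding op_adjoint_op_adjoint[OF b] .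
  qed
qed


section \<open>The two characterizations\<close>

text \<open>
  The witness \<open>\<phi>\<close> is the smallest possible one: \<open>range (\<phi> E)\<close> is the closed span of what \<open>\<U>\<close>
  makes of \<open>range E\<close>. To recover membership in \<open>\<U>\<close> at a vector \<open>x\<close>, it is tested on the smallest
  closed \<open>\<A>\<close>-invariant subspace \<open>W\<close> containing \<open>x\<close>.
\<close>

lemma reflexive_right_submodule_imp_order_hom:
  assumes A: "unital_op_algebra \<A>" and refl: "reflexive_ops \<U>" and right: "right_submodule \<A> \<U>"
  shows "\<exists>\<phi>\<in>order_homs (Lat \<A>) projections.
    \<U> = {T \<in> bounded_ops. \<forall>E\<in>Lat \<A>. T ` range E \<subseteq> range (\<phi> E)}"
proof -
  define V where "V E = closed_cspan (\<Union>T\<in>\<U>. T ` range E)" for E :: "'a \<Rightarrow> 'a"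
  define \<phi> where "\<phi> E = proj_onto (V E)" for E
  have V: "cvec.subspace (V E)" "closed (V E)" for E
    unfolding V_def by (rule csubspace_closed_cspan closed_closed_cspan)+
  have \<phi>: "\<phi> E \<in> projections" "range (\<phi> E) = V E" for E
    unfolding \<phi>_def by (rule proj_onto_in_projections[OF V] range_proj_onto[OF V])+
  have "monotone_on (Lat \<A>) proj_le proj_le \<phi>"
  proof (rule monotone_onI)
    fix E F :: "'a \<Rightarrow> 'a"
    assume "proj_le E F"
    then show "proj_le (\<phi> E) (\<phi> F)"
      unfolding proj_le_def \<phi>(2) V_def
      by (intro closed_cspan_mono UN_mono subset_refl image_mono)
  qed
  then have hom: "\<phi> \<in> order_homs (Lat \<A>) projections"
    using \<phi>(1) by (auto simp: order_homs_def)
  have Usub: "\<U> \<subseteq> bounded_ops"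
    using right by (auto simp: right_submodule_def op_subspace_def)
  have Asub: "\<A> \<subseteq> bounded_ops"
    using A by (auto simp: unital_op_algebra_def op_subspace_def)
  have "T ` range E \<subseteq> range (\<phi> E)" if "T \<in> \<U>" for T E
    unfolding \<phi>(2) V_def
    by (rule subset_trans[OF _ closed_cspan_superset]) (use that in blast)
  moreover have "T \<in> \<U>"
    if T: "T \<in> bounded_ops" and TE: "\<forall>E\<in>Lat \<A>. T ` range E \<subseteq> range (\<phi> E)" for T
  proof -
    have "T x \<in> closed_cspan ((\<lambda>S. S x) ` \<U>)" for x
    proof -
      define W where "W = closed_cspan ((\<lambda>B. B x) ` \<A>)"
      have W: "cvec.subspace W" "closed W"
        unfolding W_def by (rule csubspace_closed_cspan closed_closed_cspan)+
      \<comment> \<open>\<open>W\<close> is invariant, because \<open>\<A>\<close> is closed under products.\<close>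
      have "B y \<in> W" if B: "B \<in> \<A>" and y: "y \<in> W" for B y
      proof (rule bounded_op_closed_cspan[OF subsetD[OF Asub B] _ W y[unfolded W_def]])
        fix z assume "z \<in> (\<lambda>B. B x) ` \<A>"
        then obtain C where C: "C \<in> \<A>" "z = C x"
          by blast
        then have "(B \<circ> C) x \<in> (\<lambda>B. B x) ` \<A>"
          using A B unfolding unital_op_algebra_def by blast
        from subsetD[OF closed_cspan_superset this] show "B z \<in> W"
          unfolding W_def C(2) comp_apply .
      qed
      then have E: "proj_onto W \<in> Lat \<A>"
        by (auto simp: Lat_def range_proj_onto[OF W] proj_onto_in_projections[OF W])
      have "id x \<in> (\<lambda>B. B x) ` \<A>"
        using A unfolding unital_op_algebra_def by blast
      from subsetD[OF closed_cspan_superset this] have "x \<in> W"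
        unfolding W_def id_apply .
      then have "T x \<in> V (proj_onto W)"
        using bspec[OF TE E] unfolding \<phi>(2) range_proj_onto[OF W] by blast
      \<comment> \<open>Since \<open>\<U> \<A> \<subseteq> \<U>\<close>, on the spanning vectors \<open>C x\<close> of \<open>W\<close> nothing beyond \<open>\<U> x\<close> is reached.\<close>
      moreover have "V (proj_onto W) \<subseteq> closed_cspan ((\<lambda>S. S x) ` \<U>)"
        unfolding V_def range_proj_onto[OF W]
      proof (rule closed_cspan_minimal[OF _ csubspace_closed_cspan closed_closed_cspan], safe)
        fix S y
        assume S: "S \<in> \<U>" and y: "y \<in> W"
        show "S y \<in> closed_cspan ((\<lambda>S. S x) ` \<U>)"
        proof (rule bounded_op_closed_cspan[OF subsetD[OF Usub S] _
              csubspace_closed_cspan closed_closed_cspan y[unfolded W_def]])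
          fix z assume "z \<in> (\<lambda>B. B x) ` \<A>"
          then obtain C where C: "C \<in> \<A>" "z = C x"
            by blast
          then have "(S \<circ> C) x \<in> (\<lambda>S. S x) ` \<U>"
            using right S unfolding right_submodule_def by blast
          from subsetD[OF closed_cspan_superset this] show "S z \<in> closed_cspan ((\<lambda>S. S x) ` \<U>)"
            unfolding C(2) comp_apply .
        qed
      qed
      ultimately show ?thesis
        by blast
    qed
    then have "T \<in> Ref \<U>"
      using T by (simp add: Ref_def)
    then show ?thesis
      using refl by (simp add: reflexive_ops_def)
  qed
  ultimately have "\<U> = {T \<in> bounded_ops. \<forall>E\<in>Lat \<A>. T ` range E \<subseteq> range (\<phi> E)}"
    using Usub by blast
  with hom show ?thesis
    by blast
qed

text \<open>
  For \<open>x\<close> in \<open>range E\<close> the closed subspace \<open>range (\<phi> E)\<close> contains \<open>S x\<close> for every \<open>S\<close> in \<open>\<U>\<close>,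
  hence the closed span of these vectors, so members of \<open>Ref \<U>\<close> satisfy the same conditions.
\<close>

lemma order_hom_imp_reflexive_right_submodule:
  assumes A: "unital_op_algebra \<A>" and U: "op_subspace \<U>"
    and \<phi>: "\<phi> \<in> order_homs (Lat \<A>) projections"
    and U_eq: "\<U> = {T \<in> bounded_ops. \<forall>E\<in>Lat \<A>. T ` range E \<subseteq> range (\<phi> E)}"
  shows "reflexive_ops \<U> \<and> right_submodule \<A> \<U>"
proof
  have "T \<in> \<U>" if T: "T \<in> Ref \<U>" for T
  proof -
    have "T x \<in> range (\<phi> E)" if E: "E \<in> Lat \<A>" and x: "x \<in> range E" for E x
    proof -
      have P: "\<phi> E \<in> projections"
        using \<phi> E by (auto simp: order_homs_def)
      have "(\<lambda>S. S x) ` \<U> \<subseteq> range (\<phi> E)"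
        using E x U_eq by blast
      then have "closed_cspan ((\<lambda>S. S x) ` \<U>) \<subseteq> range (\<phi> E)"
        by (rule closed_cspan_minimal[OF _ csubspace_range_projection[OF P]
              closed_range_projection[OF P]])
      then show ?thesis
        using T by (auto simp: Ref_def)
    qed
    then show ?thesis
      using T unfolding U_eq Ref_def by auto
  qed
  moreover have "\<U> \<subseteq> Ref \<U>"
  proof
    fix T assume T: "T \<in> \<U>"
    have "T x \<in> closed_cspan ((\<lambda>S. S x) ` \<U>)" for x
      by (rule subsetD[OF closed_cspan_superset]) (use T in auto)
    moreover have "T \<in> bounded_ops"
      using T U by (auto simp: op_subspace_def)
    ultimately show "T \<in> Ref \<U>"
      by (simp add: Ref_def)
  qed
  ultimately show "reflexive_ops \<U>"
    unfolding reflexive_ops_def by blast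
next
  have "T \<circ> B \<in> \<U>" if T: "T \<in> \<U>" and B: "B \<in> \<A>" for T B
  proof -
    have "T \<in> bounded_ops" "B \<in> bounded_ops"
      using A U T B by (auto simp: unital_op_algebra_def op_subspace_def)
    then have "T \<circ> B \<in> bounded_ops"
      by (auto simp: bounded_ops_def comp_def intro: bounded_linear_compose)
    moreover have "(T \<circ> B) ` range E \<subseteq> range (\<phi> E)" if E: "E \<in> Lat \<A>" for E
    proof -
      have "B ` range E \<subseteq> range E" "T ` range E \<subseteq> range (\<phi> E)"
        using E B T U_eq by (auto simp: Lat_def)
      then show ?thesis
        unfolding image_comp[symmetric] by blast
    qed
    ultimately show ?thesis
      using U_eq by blast
  qed
  then show "right_submodule \<A> \<U>"
    using U by (simp add: right_submodule_def)
qed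

lemma reflexive_right_submodule_iff:
  assumes "unital_op_algebra \<A>" "op_subspace \<U>"
  shows "reflexive_ops \<U> \<and> right_submodule \<A> \<U> \<longleftrightarrow>
    (\<exists>\<phi>\<in>order_homs (Lat \<A>) projections.
      \<U> = {T \<in> bounded_ops. \<forall>E\<in>Lat \<A>. T ` range E \<subseteq> range (\<phi> E)})"
proof
  assume "reflexive_ops \<U> \<and> right_submodule \<A> \<U>"
  then show "\<exists>\<phi>\<in>order_homs (Lat \<A>) projections.
      \<U> = {T \<in> bounded_ops. \<forall>E\<in>Lat \<A>. T ` range E \<subseteq> range (\<phi> E)}"
    by (intro reflexive_right_submodule_imp_order_hom[OF assms(1)]) auto
next
  assume "\<exists>\<phi>\<in>order_homs (Lat \<A>) projections.
      \<U> = {T \<in> bounded_ops. \<forall>E\<in>Lat \<A>. T ` range E \<subseteq> range (\<phi> E)}"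
  then obtain \<phi> where \<phi>: "\<phi> \<in> order_homs (Lat \<A>) projections"
    and U: "\<U> = {T \<in> bounded_ops. \<forall>E\<in>Lat \<A>. T ` range E \<subseteq> range (\<phi> E)}"
    by (rule bexE)
  show "reflexive_ops \<U> \<and> right_submodule \<A> \<U>"
    by (rule order_hom_imp_reflexive_right_submodule[OF assms \<phi> U])
qed

text \<open>
  This is the right-module equivalence for the adjoint algebra and the adjoint space. The
  homomorphisms \<open>\<phi>\<close> obtained there and the homomorphisms \<open>\<psi>\<close> wanted here correspond to each
  other under the involution that conjugates by complementation.
\<close>

lemma star_reflexive_left_submodule_iff:
  assumes A: "unital_op_algebra \<A>" and U: "op_subspace \<U>"
  shows "star_reflexive_ops \<U> \<and> left_submodule \<A> \<U> \<longleftrightarrow>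
    (\<exists>\<psi>\<in>order_homs (Lat \<A>) projections.
      \<U> = {T \<in> bounded_ops. \<forall>E\<in>Lat \<A>. T ` range (\<psi> E) \<subseteq> range E})"
    (is "_ \<longleftrightarrow> (\<exists>\<psi>\<in>?H. \<U> = ?L \<psi>)")
proof -
  let ?A = "op_adjoint ` \<A>" and ?U = "op_adjoint ` \<U>"
  let ?R = "\<lambda>\<phi>. {T \<in> bounded_ops. \<forall>F\<in>Lat ?A. T ` range F \<subseteq> range (\<phi> F)}"
  let ?dual = "\<lambda>\<phi> F. proj_compl (\<phi> (proj_compl F))"
  have Asub: "\<A> \<subseteq> bounded_ops" and Usub: "\<U> \<subseteq> bounded_ops"
    using A U by (auto simp: unital_op_algebra_def op_subspace_def)
  have Lat_proj: "Lat \<B> \<subseteq> projections" for \<B> :: "('a \<Rightarrow> 'a) set"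
    by (auto simp: Lat_def)
  have L_iff: "\<U> = ?L \<psi> \<longleftrightarrow> ?U = ?R (?dual \<psi>)" if \<psi>: "\<psi> \<in> ?H" for \<psi>
  proof -
    have "op_adjoint ` ?L \<psi> = ?R (?dual \<psi>)"
      by (rule op_adjoint_image_left_conditions[OF Asub]) (use \<psi> in \<open>auto simp: order_homs_def\<close>)
    moreover have "\<U> = ?L \<psi> \<longleftrightarrow> ?U = op_adjoint ` ?L \<psi>"
    proof
      assume "?U = op_adjoint ` ?L \<psi>"
      then have "op_adjoint ` ?U = op_adjoint ` op_adjoint ` ?L \<psi>"
        by (rule arg_cong)
      then show "\<U> = ?L \<psi>"
        unfolding op_adjoint_image_invol[OF Usub] op_adjoint_image_invol[OF Collect_restrict] .
    qed (rule arg_cong)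
    ultimately show ?thesis
      by simp
  qed
  have "star_reflexive_ops \<U> \<and> left_submodule \<A> \<U> \<longleftrightarrow>
      (\<exists>\<phi>\<in>order_homs (Lat ?A) projections. ?U = ?R \<phi>)"
    unfolding star_reflexive_ops_def right_submodule_op_adjoint_iff[OF Asub U, symmetric]
    by (rule reflexive_right_submodule_iff[OF unital_op_algebra_op_adjoint[OF A]
          op_subspace_op_adjoint[OF U]])
  also have "\<dots> \<longleftrightarrow> (\<exists>\<psi>\<in>?H. ?U = ?R (?dual \<psi>))"
  proof
    assume "\<exists>\<phi>\<in>order_homs (Lat ?A) projections. ?U = ?R \<phi>"
    then obtain \<phi> where \<phi>: "\<phi> \<in> order_homs (Lat ?A) projections" "?U = ?R \<phi>"
      by blast
    have "?dual \<phi> \<in> ?H"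
      by (rule order_homs_proj_compl[OF \<phi>(1) Lat_proj proj_compl_in_Lat_op_adjoint[OF Asub]])
    moreover have "?U = ?R (?dual (?dual \<phi>))"
      using \<phi>(2) by (simp only: proj_compl_proj_compl)
    ultimately show "\<exists>\<psi>\<in>?H. ?U = ?R (?dual \<psi>)"
      by (rule bexI[where x = "?dual \<phi>", rotated])
  next
    assume "\<exists>\<psi>\<in>?H. ?U = ?R (?dual \<psi>)"
    then obtain \<psi> where \<psi>: "\<psi> \<in> ?H" "?U = ?R (?dual \<psi>)"
      by blast
    have "?dual \<psi> \<in> order_homs (Lat ?A) projections"
      by (rule order_homs_proj_compl[OF \<psi>(1) Lat_proj proj_compl_in_Lat[OF Asub]])
    with \<psi>(2) show "\<exists>\<phi>\<in>order_homs (Lat ?A) projections. ?U = ?R \<phi>"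
      by (rule bexI[where x = "?dual \<psi>"])
  qed
  also have "\<dots> \<longleftrightarrow> (\<exists>\<psi>\<in>?H. \<U> = ?L \<psi>)"
    by (rule bex_cong[OF refl]) (rule L_iff[symmetric])
  finally show ?thesis .
qed

theorem theorem2p1:
  fixes \<A> \<U> :: "('a::chilbert_space \<Rightarrow> 'a) set"
  assumes "unital_op_algebra \<A>"
    and "op_subspace \<U>"
  shows "(reflexive_ops \<U> \<and> right_submodule \<A> \<U> \<longleftrightarrow>
           (\<exists>\<phi>\<in>order_homs (Lat \<A>) projections.
              \<U> = {T \<in> bounded_ops. \<forall>E\<in>Lat \<A>. T ` range E \<subseteq> range (\<phi> E)})) \<and>
         (star_reflexive_ops \<U> \<and> left_submodule \<A> \<U> \<longleftrightarrow>
           (\<exists>\<psi>\<in>order_homs (Lat \<A>) projections.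
              \<U> = {T \<in> bounded_ops. \<forall>E\<in>Lat \<A>. T ` range (\<psi> E) \<subseteq> range E}))"
  by (rule conjI[OF reflexive_right_submodule_iff[OF assms]
        star_reflexive_left_submodule_iff[OF assms]])

end
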